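(* Let $I$ and $J$ be sets, let $\mathbb{F}$ be a field, and let $A\colon I\times J\to\mathbb{F}$, $(i,j)\mapsto a_{i,j}$, be a matrix such that for each $i\in I$ there are only finitely many $j\in J$ with $a_{i,j}\neq 0$. Suppose that the (possibly infinite) homogeneous linear equation system \[\sum_{j\in J} a_{i,j}x_j=0\quad (i\in I)\] has only the trivial solution, i.e. the only $\lambda\in\mathbb{F}^J$ with $\sum_{j\in J}a_{i,j}\lambda_j=0$ for all $i\in I$ is $\lambda=0$. Then there is an injection $\varphi\colon J\to I$ such that $a_{\varphi(j),j}\neq 0$ for every $j\in J$.
   Context: For each $i\in I$ the sum $\sum_{j\in J}a_{i,j}\lambda_j$ has only finitely many non-zero summands (because only finitely many $a_{i,j}$ are non-zero), so it is a well-defined element of $\mathbb{F}$. *)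

theory Defs
  imports Main
begin

end

theory Submission
  imports Defs "HOL.Vector_Spaces" "HOL-Library.Function_Algebras"
begin

text \<open>
  Triviality of the kernel means, by duality, that every unit vector is a finite linear combination
  of rows. This property survives deleting a column \<open>k\<close> together with a suitable row \<open>i\<close> such that
  \<open>a i k \<noteq> 0\<close>, so a matching can be enlarged greedily through finitely many columns at a time.
  Doing this countably often, each time covering the supports of the rows used so far, gives a
  matching that is closed: the matched rows vanish on the unmatched columns. Deleting a closed
  matching, however large, keeps the spanning property, and closedness is preserved by unions of
  chains, so Zorn's lemma yields a closed matching that covers all columns.
\<close>

section \<open>Spanning of unit vectors by rows: duality and elimination\<close>

definition unit_combination ::
    "('i \<Rightarrow> 'j \<Rightarrow> 'f::field) \<Rightarrow> 'j set \<Rightarrow> 'j \<Rightarrow> 'i set \<Rightarrow> ('i \<Rightarrow> 'f) \<Rightarrow> bool" where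
  "unit_combination a J k T b \<longleftrightarrow> finite T \<and> (\<forall>j\<in>J. (\<Sum>i\<in>T. b i * a i j) = of_bool (j = k))"

text \<open>Everything is relative to \<open>I\<close> and \<open>J\<close>, so deleting rows and
  columns only shrinks the index sets and never changes the matrix \<open>a\<close>.\<close>

definition row_spanning :: "('i \<Rightarrow> 'j \<Rightarrow> 'f::field) \<Rightarrow> 'i set \<Rightarrow> 'j set \<Rightarrow> bool" where
  "row_spanning a I J \<longleftrightarrow> (\<forall>k\<in>J. \<exists>T b. T \<subseteq> I \<and> unit_combination a J k T b)"

lemma sum_unit_vectors:
  fixes c :: "'j \<Rightarrow> 'f::field"
  assumes "finite S"
  shows "(\<Sum>j\<in>S. (\<lambda>x. c j * of_bool (x = j))) = (\<lambda>x. if x \<in> S then c x else 0)"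
  using assms by induction (auto simp: fun_eq_iff)

text \<open>If a unit vector \<open>e k\<close> were outside the span of the rows, some linear
  functional \<open>g\<close> would vanish on all rows and take the value 1 at \<open>e k\<close>.
  Then the values \<open>g (e j)\<close> would form a nontrivial solution: each row is a finite
  combination of unit vectors, so \<open>g\<close> can be evaluated on it term by term.\<close>

lemma row_spanning_if_only_trivial:
  fixes a :: "'i \<Rightarrow> 'j \<Rightarrow> 'f::field"
  assumes row_finite: "\<And>i. i \<in> I \<Longrightarrow> finite {j \<in> J. a i j \<noteq> 0}"
    and only_trivial: "\<And>l :: 'j \<Rightarrow> 'f.
      (\<And>i. i \<in> I \<Longrightarrow> sum' (\<lambda>j. a i j * l j) J = 0) \<Longrightarrow> (\<forall>j\<in>J. l j = 0)"
  shows "row_spanning a I J"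
  unfolding row_spanning_def
proof
  fix k assume k: "k \<in> J"
  define s :: "'f \<Rightarrow> ('j \<Rightarrow> 'f) \<Rightarrow> 'j \<Rightarrow> 'f" where "s = (\<lambda>c v j. c * v j)"
  define e :: "'j \<Rightarrow> 'j \<Rightarrow> 'f" where "e = (\<lambda>j x. of_bool (x = j))"
  \<comment> \<open>Cutting off outside \<open>J\<close> makes each row a finite combination of the
    \<open>e j\<close> with \<open>j\<close> in \<open>J\<close>; \<open>row_finite\<close> says
    nothing about entries outside \<open>J\<close>.\<close>
  define r where "r = (\<lambda>i j. if j \<in> J then a i j else 0)"
  interpret V: vector_space_pair s "(*) :: 'f \<Rightarrow> 'f \<Rightarrow> 'f"
    by unfold_locales (auto simp: s_def fun_eq_iff algebra_simps)
  have "e k \<in> V.vs1.span (r ` I)"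
  proof (rule ccontr)
    assume nin: "e k \<notin> V.vs1.span (r ` I)"
    \<comment> \<open>A functional can be prescribed freely only on an independent set, so the rows
      are replaced by a basis \<open>B\<close> of their span.\<close>
    obtain B where B: "B \<subseteq> r ` I" "V.vs1.independent B" "r ` I \<subseteq> V.vs1.span B"
      by (rule V.vs1.maximal_independent_subset)
    have "e k \<notin> V.vs1.span B"
      using nin V.vs1.span_mono[OF B(1)] by blast
    then have ind: "V.vs1.independent (insert (e k) B)" and ekB: "e k \<notin> B"
      using B(2) V.vs1.independent_insertI V.vs1.span_base by auto
    obtain g where lin: "Vector_Spaces.linear s (*) g"
      and g: "\<forall>v\<in>insert (e k) B. g v = (if v = e k then 1 else 0)"
      using V.linear_independent_extend[OF ind, of "\<lambda>v. if v = e k then 1 else 0"] by blast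
    have gB: "g v = 0" if "v \<in> V.vs1.span B" for v
    proof (rule V.linear_eq_0_on_span[OF lin _ that])
      show "g x = 0" if "x \<in> B" for x using g ekB that by auto
    qed
    have "sum' (\<lambda>j. a i j * g (e j)) J = 0" if i: "i \<in> I" for i
    proof -
      let ?S = "{j \<in> J. a i j \<noteq> 0}"
      have fin: "finite ?S" using row_finite i .
      have "r i = (\<Sum>j\<in>?S. s (a i j) (e j))"
        unfolding s_def e_def sum_unit_vectors[OF fin] by (auto simp: r_def)
      then have "g (r i) = (\<Sum>j\<in>?S. a i j * g (e j))"
        by (simp only: V.linear_sum[OF lin] V.linear_scale[OF lin])
      moreover have "g (r i) = 0" using gB B(3) i by blast
      ultimately have "(\<Sum>j\<in>?S. a i j * g (e j)) = 0" by simp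
      \<comment> \<open>\<open>sum'\<close> ranges over the nonzero summands only, which may be
        fewer than the support \<open>?S\<close> of the row.\<close>
      moreover have "(\<Sum>j\<in>{j \<in> J. a i j * g (e j) \<noteq> 0}. a i j * g (e j)) = (\<Sum>j\<in>?S. a i j * g (e j))"
        by (rule sum.mono_neutral_left[OF fin]) auto
      ultimately show ?thesis by (simp add: sum.G_def)
    qed
    then have "g (e k) = 0" using only_trivial[of "\<lambda>j. g (e j)"] k by blast
    then show False using g by simp
  qed
  then obtain t u where t: "finite t" "t \<subseteq> r ` I" and ek: "e k = (\<Sum>v\<in>t. s (u v) v)"
    unfolding V.vs1.span_explicit by blast
  \<comment> \<open>Different indices may carry equal rows; one index is picked for each vector in
    \<open>t\<close>, so that the sum can be reindexed.\<close>
  obtain T where T: "T \<subseteq> I" "inj_on r T" "t = r ` T"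
    using t(2) by (meson subset_image_inj)
  have finT: "finite T" using T t(1) finite_image_iff by blast
  have "(\<Sum>i\<in>T. u (r i) * a i j) = of_bool (j = k)" if j: "j \<in> J" for j
  proof -
    have "of_bool (j = k) = (\<Sum>i\<in>T. s (u (r i)) (r i)) j"
      using ek T by (simp add: e_def sum.reindex fun_eq_iff)
    also have "\<dots> = (\<Sum>i\<in>T. u (r i) * a i j)"
      using finT by induction (auto simp: s_def r_def j)
    finally show ?thesis by simp
  qed
  with finT have "unit_combination a J k T (\<lambda>i. u (r i))"
    by (simp add: unit_combination_def)
  with T(1) show "\<exists>T b. T \<subseteq> I \<and> unit_combination a J k T b" by blast
qed

text \<open>One step of Gaussian elimination. Some row \<open>i\<close> in the combination for the
  unit vector at \<open>k\<close> has a nonzero coefficient and a nonzero entry in column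
  \<open>k\<close>. That combination vanishes on \<open>J - {k}\<close>, so multiples of it can be
  subtracted from any other combination to eliminate row \<open>i\<close> without any effect on the
  remaining columns.\<close>

lemma row_spanning_delete:
  assumes sp: "row_spanning a I J" and k: "k \<in> J"
  obtains i where "i \<in> I" "a i k \<noteq> 0" "row_spanning a (I - {i}) (J - {k})"
proof -
  obtain T b where "T \<subseteq> I" "unit_combination a J k T b"
    using sp k unfolding row_spanning_def by blast
  then have T: "finite T" "T \<subseteq> I" "\<And>j. j \<in> J \<Longrightarrow> (\<Sum>i\<in>T. b i * a i j) = of_bool (j = k)"
    by (auto simp: unit_combination_def)
  have "(\<Sum>i\<in>T. b i * a i k) \<noteq> 0" using T(3)[OF k] by simp
  then obtain i where i: "i \<in> T" "b i * a i k \<noteq> 0"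
    by (meson sum.neutral)
  have "\<exists>U d. U \<subseteq> I - {i} \<and> unit_combination a (J - {k}) l U d" if l: "l \<in> J - {k}" for l
  proof -
    obtain S c where "S \<subseteq> I" "unit_combination a J l S c"
      using sp l unfolding row_spanning_def by blast
    then have S: "finite S" "S \<subseteq> I" "\<And>j. j \<in> J \<Longrightarrow> (\<Sum>i\<in>S. c i * a i j) = of_bool (j = l)"
      by (auto simp: unit_combination_def)
    \<comment> \<open>Extension by zero lets both combinations be summed over
      \<open>S \<union> T\<close>; the factor in \<open>d\<close> is chosen to give
      \<open>d i = 0\<close>.\<close>
    define b' c' where "b' = (\<lambda>i. if i \<in> T then b i else 0)" and "c' = (\<lambda>i. if i \<in> S then c i else 0)"
    define d where "d = (\<lambda>x. c' x - c' i / b' i * b' x)"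
    have "b' i \<noteq> 0" using i by (auto simp: b'_def)
    then have di: "d i = 0" by (simp add: d_def)
    have "(\<Sum>x\<in>S \<union> T - {i}. d x * a x j) = of_bool (j = l)" if j: "j \<in> J - {k}" for j
    proof -
      have b: "(\<Sum>x\<in>S \<union> T. b' x * a x j) = 0"
      proof -
        have "(\<Sum>x\<in>S \<union> T. b' x * a x j) = (\<Sum>x\<in>T. b x * a x j)"
          by (rule sum.mono_neutral_cong_right) (use S T in \<open>auto simp: b'_def\<close>)
        then show ?thesis using T(3) j by simp
      qed
      have c: "(\<Sum>x\<in>S \<union> T. c' x * a x j) = of_bool (j = l)"
      proof -
        have "(\<Sum>x\<in>S \<union> T. c' x * a x j) = (\<Sum>x\<in>S. c x * a x j)"
          by (rule sum.mono_neutral_cong_right) (use S T in \<open>auto simp: c'_def\<close>)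
        then show ?thesis using S(3) j by simp
      qed
      have "(\<Sum>x\<in>S \<union> T - {i}. d x * a x j) = (\<Sum>x\<in>S \<union> T. d x * a x j)"
        by (rule sum.mono_neutral_left) (use S T di in auto)
      also have "\<dots> = (\<Sum>x\<in>S \<union> T. c' x * a x j) - c' i / b' i * (\<Sum>x\<in>S \<union> T. b' x * a x j)"
        by (simp add: d_def left_diff_distrib sum_subtractf sum_distrib_left mult.assoc)
      finally show ?thesis using b c by simp
    qed
    then have "unit_combination a (J - {k}) l (S \<union> T - {i}) d"
      using S T by (simp add: unit_combination_def)
    moreover have "S \<union> T - {i} \<subseteq> I - {i}" using S T by auto
    ultimately show ?thesis by blast
  qed
  then have "row_spanning a (I - {i}) (J - {k})" unfolding row_spanning_def by blast
  with that i T show thesis by auto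
qed

section \<open>Partial matchings within the support of the matrix\<close>

definition support_matching :: "('i \<Rightarrow> 'j \<Rightarrow> 'f::field) \<Rightarrow> 'i set \<Rightarrow> 'j set \<Rightarrow> ('j \<times> 'i) set \<Rightarrow> bool" where
  "support_matching a I J M \<longleftrightarrow> M \<subseteq> J \<times> I \<and> single_valued M \<and> single_valued (M\<inverse>) \<and>
    (\<forall>(j, i)\<in>M. a i j \<noteq> 0)"

text \<open>Matchings are relations, so limits are plain unions. Each condition concerns at most two
  pairs, and any two pairs of the union already lie in one member of the chain.\<close>

lemma support_matching_Union_chain:
  assumes "subset.chain (Collect (support_matching a I J)) C"
  shows "support_matching a I J (\<Union>C)"
proof -
  have C: "support_matching a I J M" if "M \<in> C" for M
    using assms that by (auto simp: subset.chain_def)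
  have dir: "\<exists>M\<in>C. p \<in> M \<and> q \<in> M" if "p \<in> \<Union>C" "q \<in> \<Union>C" for p q
    using assms that unfolding subset_chain_def by blast
  have "single_valued (\<Union>C)"
    unfolding single_valued_def
  proof (intro allI impI)
    fix x y z assume "(x, y) \<in> \<Union>C" "(x, z) \<in> \<Union>C"
    then show "y = z"
      using dir C unfolding support_matching_def single_valued_def by metis
  qed
  moreover have "single_valued ((\<Union>C)\<inverse>)"
    unfolding single_valued_def
  proof (intro allI impI)
    fix x y z assume "(x, y) \<in> (\<Union>C)\<inverse>" "(x, z) \<in> (\<Union>C)\<inverse>"
    then have "(y, x) \<in> \<Union>C" "(z, x) \<in> \<Union>C" by auto
    then obtain M where "M \<in> C" "(y, x) \<in> M" "(z, x) \<in> M"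
      using dir by metis
    then show "y = z"
      using C[of M] unfolding support_matching_def single_valued_def by blast
  qed
  ultimately show ?thesis
    using C unfolding support_matching_def by blast
qed

section \<open>Spanning after removal of a matching, and closed matchings\<close>

definition residual_spanning :: "('i \<Rightarrow> 'j \<Rightarrow> 'f::field) \<Rightarrow> 'i set \<Rightarrow> 'j set \<Rightarrow> ('j \<times> 'i) set \<Rightarrow> bool" where
  "residual_spanning a I J M \<longleftrightarrow>
    support_matching a I J M \<and> row_spanning a (I - Range M) (J - Domain M)"

text \<open>Zorn's lemma cannot be applied to \<open>residual_spanning\<close> directly, as it may
  fail for the union of a chain: with columns 0, 1, 2, ... and rows e_n and e_0 + e_n for n >= 1,
  matching column n to e_0 + e_n for more and more n leaves, in the limit, column 0 with zero
  entries only.\<close>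

definition closed_matching :: "('i \<Rightarrow> 'j \<Rightarrow> 'f::field) \<Rightarrow> 'i set \<Rightarrow> 'j set \<Rightarrow> ('j \<times> 'i) set \<Rightarrow> bool" where
  "closed_matching a I J M \<longleftrightarrow>
    support_matching a I J M \<and> (\<forall>i\<in>Range M. {j \<in> J. a i j \<noteq> 0} \<subseteq> Domain M)"

lemma closed_matching_residual_spanning:
  assumes cl: "closed_matching a I J M" and sp: "row_spanning a I J"
  shows "residual_spanning a I J M"
proof -
  have "\<exists>U d. U \<subseteq> I - Range M \<and> unit_combination a (J - Domain M) k U d" if k: "k \<in> J - Domain M" for k
  proof -
    obtain T b where "T \<subseteq> I" "unit_combination a J k T b"
      using sp k unfolding row_spanning_def by blast
    then have T: "finite T" "T \<subseteq> I" "\<And>j. j \<in> J \<Longrightarrow> (\<Sum>i\<in>T. b i * a i j) = of_bool (j = k)"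
      by (auto simp: unit_combination_def)
    have "(\<Sum>i\<in>T - Range M. b i * a i j) = of_bool (j = k)" if j: "j \<in> J - Domain M" for j
    proof -
      have "(\<Sum>i\<in>T - Range M. b i * a i j) = (\<Sum>i\<in>T. b i * a i j)"
        by (rule sum.mono_neutral_left) (use T cl j in \<open>auto simp: closed_matching_def\<close>)
      then show ?thesis using T(3) j by simp
    qed
    then have "unit_combination a (J - Domain M) k (T - Range M) b"
      using T by (simp add: unit_combination_def)
    moreover have "T - Range M \<subseteq> I - Range M" using T(2) by (rule Diff_mono) simp
    ultimately show ?thesis by (intro exI conjI)
  qed
  then have "row_spanning a (I - Range M) (J - Domain M)"
    unfolding row_spanning_def by simp
  with cl show ?thesis by (simp add: residual_spanning_def closed_matching_def)
qed

text \<open>One deletion for each uncovered column of \<open>S\<close>. Finiteness of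
  \<open>N - M\<close> is recorded because then the new rows have only finitely many support columns
  in total, and the lemma can be applied again.\<close>

lemma residual_spanning_extend:
  assumes "residual_spanning a I J M" "finite S" "S \<subseteq> J"
  obtains N where "residual_spanning a I J N" "M \<subseteq> N" "S \<subseteq> Domain N" "finite (N - M)"
proof -
  have "\<exists>N. residual_spanning a I J N \<and> M \<subseteq> N \<and> S \<subseteq> Domain N \<and> finite (N - M)"
    using assms(2,3)
  proof (induction S)
    case empty
    then show ?case using assms(1) by (intro exI[of _ M]) auto
  next
    case (insert k S)
    then obtain N where N: "residual_spanning a I J N" "M \<subseteq> N" "S \<subseteq> Domain N" "finite (N - M)"
      by auto
    show ?case
    proof (cases "k \<in> Domain N")
      case True
      with N show ?thesis by blast
    next
      case False
      then obtain i where i: "i \<in> I - Range N" "a i k \<noteq> 0"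
          "row_spanning a (I - Range N - {i}) (J - Domain N - {k})"
        using N(1) insert.prems row_spanning_delete[of a "I - Range N" "J - Domain N" k]
        unfolding residual_spanning_def by blast
      have "I - Range (insert (k, i) N) = I - Range N - {i}"
          "J - Domain (insert (k, i) N) = J - Domain N - {k}" by auto
      then have "residual_spanning a I J (insert (k, i) N)"
        using i N(1) False insert.prems
        unfolding residual_spanning_def support_matching_def single_valued_def by auto
      moreover have "finite (insert (k, i) N - M)"
        using N(4) by (simp add: insert_Diff_if)
      ultimately show ?thesis using N by (intro exI[of _ "insert (k, i) N"]) auto
    qed
  qed
  then show thesis using that by blast
qed

lemma closed_matching_extend:
  assumes row_finite: "\<And>i. i \<in> I \<Longrightarrow> finite {j \<in> J. a i j \<noteq> 0}"
    and sp: "row_spanning a I J" and cl: "closed_matching a I J M" and k: "k \<in> J"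
  obtains N where "closed_matching a I J N" "M \<subseteq> N" "k \<in> Domain N"
proof -
  define P where "P = (\<lambda>N. residual_spanning a I J N \<and> M \<subseteq> N \<and> k \<in> Domain N \<and> finite (N - M))"
  \<comment> \<open>Each stage covers the supports of the rows used one stage earlier, so the union
    of all stages is closed although no single stage need be.\<close>
  define Q where "Q = (\<lambda>N N'. N \<subseteq> N' \<and> (\<forall>i\<in>Range N. {j \<in> J. a i j \<noteq> 0} \<subseteq> Domain N'))"
  have "\<exists>f. \<forall>n::nat. P (f n) \<and> Q (f n) (f (Suc n))"
  proof (rule dependent_nat_choice)
    show "\<exists>N. P N"
      using residual_spanning_extend[OF closed_matching_residual_spanning[OF cl sp], of "{k}"] k
      unfolding P_def by (metis empty_subsetI finite.emptyI finite.insertI insert_subset)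
  next
    fix N and n :: nat assume N: "P N"
    \<comment> \<open>Rows of \<open>M\<close> already have their supports inside
      \<open>Domain M\<close>; considering only the new rows keeps \<open>S\<close> finite even if
      \<open>M\<close> is infinite.\<close>
    define S where "S = (\<Union>i\<in>Range (N - M). {j \<in> J. a i j \<noteq> 0})"
    have "Range (N - M) \<subseteq> I"
      using N unfolding P_def residual_spanning_def support_matching_def by auto
    then have "finite S" "S \<subseteq> J"
      using N row_finite unfolding S_def P_def by (auto intro!: finite_UN_I finite_Range)
    then obtain N' where N': "residual_spanning a I J N'" "N \<subseteq> N'" "S \<subseteq> Domain N'" "finite (N' - N)"
      using residual_spanning_extend N unfolding P_def by metis
    have "N' - M \<subseteq> (N' - N) \<union> (N - M)" by auto
    then have "finite (N' - M)" using N N'(4) finite_subset unfolding P_def by blast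
    then have "P N'" using N N' unfolding P_def by blast
    moreover have "{j \<in> J. a i j \<noteq> 0} \<subseteq> Domain N'" if i: "i \<in> Range N" for i
    proof (cases "i \<in> Range M")
      case True
      then have "{j \<in> J. a i j \<noteq> 0} \<subseteq> Domain M" using cl unfolding closed_matching_def by blast
      then show ?thesis using N N'(2) unfolding P_def by blast
    next
      case False
      then have "i \<in> Range (N - M)" using i by blast
      then show ?thesis using N'(3) unfolding S_def by blast
    qed
    ultimately show "\<exists>N'. P N' \<and> Q N N'" using N'(2) unfolding Q_def by blast
  qed
  then obtain f where f: "\<And>n. P (f n)" "\<And>n. Q (f n) (f (Suc n))" by blast
  have mono: "f m \<subseteq> f n" if "m \<le> n" for m n
    using that f(2) lift_Suc_mono_le[of f] unfolding Q_def by blast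
  have "subset.chain (Collect (support_matching a I J)) (range f)"
    unfolding subset_chain_def using f(1) mono nat_le_linear
    by (auto simp: P_def residual_spanning_def) (metis subsetD)+
  then have "support_matching a I J (\<Union>(range f))"
    by (rule support_matching_Union_chain)
  moreover have "{j \<in> J. a i j \<noteq> 0} \<subseteq> Domain (\<Union>(range f))" if "i \<in> Range (\<Union>(range f))" for i
  proof -
    obtain n where "i \<in> Range (f n)" using \<open>i \<in> Range (\<Union>(range f))\<close> by blast
    then have "{j \<in> J. a i j \<noteq> 0} \<subseteq> Domain (f (Suc n))" using f(2)[of n] unfolding Q_def by blast
    then show ?thesis by blast
  qed
  ultimately have "closed_matching a I J (\<Union>(range f))" unfolding closed_matching_def by blast
  moreover have "M \<subseteq> \<Union>(range f)" "k \<in> Domain (\<Union>(range f))"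
    using f(1)[of 0] unfolding P_def by blast+
  ultimately show thesis using that by blast
qed

section \<open>Maximal closed matchings cover all columns\<close>

theorem theorem1:
  fixes I :: "'i set" and J :: "'j set" and a :: "'i \<Rightarrow> 'j \<Rightarrow> 'f::field"
  assumes row_finite: "\<And>i. i \<in> I \<Longrightarrow> finite {j \<in> J. a i j \<noteq> 0}"
    and only_trivial: "\<And>l :: 'j \<Rightarrow> 'f.
      (\<And>i. i \<in> I \<Longrightarrow> sum' (\<lambda>j. a i j * l j) J = 0) \<Longrightarrow> (\<forall>j\<in>J. l j = 0)"
  shows "\<exists>\<phi> :: 'j \<Rightarrow> 'i. \<phi> ` J \<subseteq> I \<and> inj_on \<phi> J \<and> (\<forall>j\<in>J. a (\<phi> j) j \<noteq> 0)"
proof -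
  have sp: "row_spanning a I J"
    using row_spanning_if_only_trivial row_finite only_trivial by blast
  have "\<exists>M\<in>Collect (closed_matching a I J). \<forall>X\<in>Collect (closed_matching a I J). M \<subseteq> X \<longrightarrow> X = M"
  proof (rule subset_Zorn', goal_cases)
    case (1 C)
    then have "subset.chain (Collect (support_matching a I J)) C"
      unfolding subset_chain_def closed_matching_def by blast
    then have "support_matching a I J (\<Union>C)" by (rule support_matching_Union_chain)
    moreover have "\<forall>i\<in>Range (\<Union>C). {j \<in> J. a i j \<noteq> 0} \<subseteq> Domain (\<Union>C)"
    proof
      fix i assume "i \<in> Range (\<Union>C)"
      then obtain M where M: "M \<in> C" "i \<in> Range M" by blast
      then have "{j \<in> J. a i j \<noteq> 0} \<subseteq> Domain M"
        using 1 unfolding subset_chain_def closed_matching_def by blast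
      also have "\<dots> \<subseteq> Domain (\<Union>C)" using M by blast
      finally show "{j \<in> J. a i j \<noteq> 0} \<subseteq> Domain (\<Union>C)" .
    qed
    ultimately show ?case unfolding closed_matching_def by blast
  qed
  then obtain M where M: "closed_matching a I J M"
    and max: "\<And>X. closed_matching a I J X \<Longrightarrow> M \<subseteq> X \<Longrightarrow> X = M" by blast
  \<comment> \<open>A closed extension of \<open>M\<close> through \<open>j\<close> equals
    \<open>M\<close> by maximality, so \<open>j\<close> was matched from the start.\<close>
  have "j \<in> Domain M" if "j \<in> J" for j
    using closed_matching_extend[OF row_finite sp M that] max by metis
  then have "\<forall>j\<in>J. \<exists>i. (j, i) \<in> M" by blast
  then obtain \<phi> where \<phi>: "\<And>j. j \<in> J \<Longrightarrow> (j, \<phi> j) \<in> M" by metis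
  have "M \<subseteq> J \<times> I" "single_valued (M\<inverse>)" "\<forall>(j, i)\<in>M. a i j \<noteq> 0"
    using M unfolding closed_matching_def support_matching_def by auto
  then have "\<phi> ` J \<subseteq> I" and "\<forall>j\<in>J. a (\<phi> j) j \<noteq> 0"
    using \<phi> by blast+
  moreover have "inj_on \<phi> J"
  proof (rule inj_onI)
    fix x y assume "x \<in> J" "y \<in> J" "\<phi> x = \<phi> y"
    then have "(\<phi> x, x) \<in> M\<inverse>" "(\<phi> x, y) \<in> M\<inverse>" using \<phi>[of x] \<phi>[of y] by auto
    then show "x = y" using \<open>single_valued (M\<inverse>)\<close> by (blast dest: single_valuedD)
  qed
  ultimately show ?thesis by blast
qed

end
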